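(* There is an algorithm with running time $O(n^4)$ which, given an arbitrary $n\times n$ matrix $M$ with entries in $\mathbb{Z}_2$, computes a number $k$ such that $k/2\le R(M)\le k$.
   Context: For an $n\times n$ matrix $M$ with entries in $\mathbb{Z}_2$, $R(M)$ denotes the minimal rank (over $\mathbb{Z}_2$) among all matrices obtained from $M$ by changing some (possibly none) of the entries on the main diagonal of $M$, i.e. $R(M)=\min\{\operatorname{rk}(M+D): D \text{ an } n\times n \text{ diagonal matrix over } \mathbb{Z}_2\}$. Complexity is measured in elementary operations on entries of $\mathbb{Z}_2$. *)

theory Defs
  imports "HOL-Library.Z2" "Jordan_Normal_Form.DL_Rank"
begin

definition minrank_diag :: "nat \<Rightarrow> bit mat \<Rightarrow> nat" where
  "minrank_diag n M =
     (LEAST r. \<exists>D. D \<in> carrier_mat n n \<and> diagonal_mat D \<and>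
                   r = vec_space.rank n (M + D :: bit mat))"

text \<open>A program is a list of instructions.  Registers and memory cells hold
  natural numbers; each executed instruction costs one unit of time.
  Arithmetic is restricted to addition and truncated subtraction.\<close>

datatype instr =
    Const nat nat
  | Add nat nat nat
  | Sub nat nat nat
  | Load nat nat
  | Store nat nat
  | Jz nat nat
  | Jmp nat
  | Halt

record conf =
  pc :: nat
  regs :: "nat \<Rightarrow> nat"
  mem :: "nat \<Rightarrow> nat"

definition halted :: "instr list \<Rightarrow> conf \<Rightarrow> bool" where
  "halted P c \<longleftrightarrow> pc c \<ge> length P \<or> P ! pc c = Halt"

fun exec_instr :: "instr \<Rightarrow> conf \<Rightarrow> conf" where
  "exec_instr (Const r v) c = c\<lparr>pc := Suc (pc c), regs := (regs c)(r := v)\<rparr>"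
| "exec_instr (Add r a b) c =
     c\<lparr>pc := Suc (pc c), regs := (regs c)(r := regs c a + regs c b)\<rparr>"
| "exec_instr (Sub r a b) c =
     c\<lparr>pc := Suc (pc c), regs := (regs c)(r := regs c a - regs c b)\<rparr>"
| "exec_instr (Load r a) c =
     c\<lparr>pc := Suc (pc c), regs := (regs c)(r := mem c (regs c a))\<rparr>"
| "exec_instr (Store a r) c =
     c\<lparr>pc := Suc (pc c), mem := (mem c)(regs c a := regs c r)\<rparr>"
| "exec_instr (Jz r l) c =
     c\<lparr>pc := (if regs c r = 0 then l else Suc (pc c))\<rparr>"
| "exec_instr (Jmp l) c = c\<lparr>pc := l\<rparr>"
| "exec_instr Halt c = c"

definition step :: "instr list \<Rightarrow> conf \<Rightarrow> conf" where
  "step P c = (if halted P c then c else exec_instr (P ! pc c) c)"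

definition run :: "instr list \<Rightarrow> nat \<Rightarrow> conf \<Rightarrow> conf" where
  "run P t c = (step P ^^ t) c"

text \<open>Input encoding: register 0 holds n, memory cell i*n+j holds entry
  (i,j) of M as 0 or 1; everything else is 0.  Output: register 0 on halt.\<close>

definition bit_val :: "bit \<Rightarrow> nat" where
  "bit_val b = (if b = 1 then 1 else 0)"

definition init_conf :: "nat \<Rightarrow> bit mat \<Rightarrow> conf" where
  "init_conf n M =
     \<lparr>pc = 0, regs = (\<lambda>_. 0)(0 := n),
      mem = (\<lambda>a. if a < n * n then bit_val (M $$ (a div n, a mod n)) else 0)\<rparr>"

end

theory Submission
  imports Defs
begin

text \<open>Over \<open>\<int>\<^sub>2\<close> every column \<open>k\<close> of \<open>M + D\<close> is one of the two vectors \<open>M\<^sub>k\<close>, \<open>M\<^sub>k + e\<^sub>k\<close>. Start with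
  the zero space \<open>W\<close>, scan the columns, and whenever \<open>W\<close> contains neither candidate enlarge \<open>W\<close> by
  both. If this happens \<open>s\<close> times, then \<open>dim W \<le> 2 s\<close>, and \<open>W\<close> finally contains a candidate for every
  column, so \<open>R(M) \<le> 2 s\<close>. Conversely, whatever \<open>D\<close> is, its column at each enlargement lies outside
  the current \<open>W\<close> while the columns at all earlier enlargements lie inside, so these \<open>s\<close> columns of
  \<open>M + D\<close> are linearly independent and \<open>s \<le> R(M)\<close>. Hence \<open>k = 2 s\<close> works.

  Membership in \<open>W\<close> is decided by keeping all \<open>2 n\<close> candidates modulo \<open>W\<close> in a table: dividing out a
  vector is one round of Gaussian elimination, and membership means that the row is zero. Every loop
  has a fixed trip count, which gives \<open>O(n\<^sup>4)\<close> steps.\<close>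

section \<open>Structured programs\<close>

datatype com =
    Block "instr list"
  | Seq com com
  | IfNZ nat com
  | Loop nat com

fun len :: "com \<Rightarrow> nat" where
  "len (Block is) = length is"
| "len (Seq c d) = len c + len d"
| "len (IfNZ r c) = len c + 1"
| "len (Loop r c) = len c + 4"

fun compile :: "nat \<Rightarrow> com \<Rightarrow> instr list" where
  "compile a (Block is) = is"
| "compile a (Seq c d) = compile a c @ compile (a + len c) d"
| "compile a (IfNZ r c) = Jz r (a + len c + 1) # compile (a + 1) c"
| "compile a (Loop r c) =
     Jz r (a + len c + 4) # compile (a + 1) c @ [Const 1 1, Sub r r 1, Jmp a]"

lemma length_compile [simp]: "length (compile a c) = len c"
  by (induction c arbitrary: a) auto

type_synonym assn = "(nat \<Rightarrow> nat) \<Rightarrow> (nat \<Rightarrow> nat) \<Rightarrow> bool"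

definition valid :: "assn \<Rightarrow> com \<Rightarrow> assn \<Rightarrow> nat \<Rightarrow> bool" where
  "valid P c Q T \<longleftrightarrow>
     (\<forall>pre post R m. P R m \<longrightarrow>
        (\<exists>t\<le>T. \<exists>R' m'. Q R' m' \<and>
           run (pre @ compile (length pre) c @ post) t \<lparr>pc = length pre, regs = R, mem = m\<rparr>
             = \<lparr>pc = length pre + len c, regs = R', mem = m'\<rparr>))"

lemma validD:
  assumes "valid P c Q T" "P R m" "prog = pre @ compile a c @ post" "a = length pre"
  obtains t R' m' where "t \<le> T" "Q R' m'"
    "run prog t \<lparr>pc = a, regs = R, mem = m\<rparr> = \<lparr>pc = a + len c, regs = R', mem = m'\<rparr>"
  using assms unfolding valid_def by blast

lemma run_0 [simp]: "run P 0 c = c"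
  by (simp add: run_def)

lemma run_Suc: "run P (Suc t) c = run P t (step P c)"
  by (simp add: run_def funpow_Suc_right del: funpow.simps)

lemma run_add: "run P (t + u) c = run P u (run P t c)"
  by (induction t arbitrary: c) (simp_all add: run_Suc)

lemma step_at:
  assumes "prog = pre @ i # post" "pc c = length pre" "i \<noteq> Halt"
  shows "step prog c = exec_instr i c"
  using assms by (simp add: step_def halted_def)

lemma valid_conseq:
  assumes "valid P' c Q' T'" "\<And>R m. P R m \<Longrightarrow> P' R m" "\<And>R m. Q' R m \<Longrightarrow> Q R m" "T' \<le> T"
  shows "valid P c Q T"
  using assms unfolding valid_def by (meson order_trans)

lemma valid_ex:
  assumes "\<And>x. valid (P x) c Q T"
  shows "valid (\<lambda>R m. \<exists>x. P x R m) c Q T"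
  using assms unfolding valid_def by blast

fun wp_block :: "instr list \<Rightarrow> assn \<Rightarrow> assn" where
  "wp_block [] Q R m = Q R m"
| "wp_block (Const r v # is) Q R m = wp_block is Q (R(r := v)) m"
| "wp_block (Add r a b # is) Q R m = wp_block is Q (R(r := R a + R b)) m"
| "wp_block (Sub r a b # is) Q R m = wp_block is Q (R(r := R a - R b)) m"
| "wp_block (Load r a # is) Q R m = wp_block is Q (R(r := m (R a))) m"
| "wp_block (Store a r # is) Q R m = wp_block is Q R (m(R a := R r))"
| "wp_block _ Q R m = False"

lemma run_wp_block:
  assumes "wp_block is Q R m"
  shows "\<exists>R' m'. Q R' m' \<and>
    run (pre @ is @ post) (length is) \<lparr>pc = length pre, regs = R, mem = m\<rparr>
      = \<lparr>pc = length pre + length is, regs = R', mem = m'\<rparr>"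
  using assms
proof (induction "is" Q R m arbitrary: pre rule: wp_block.induct)
  case (2 r v "is" Q R m)
  from "2.IH"[of "pre @ [Const r v]"] "2.prems" show ?case by (auto simp: run_Suc step_at fun_upd_def)
next
  case (3 r a b "is" Q R m)
  from "3.IH"[of "pre @ [Add r a b]"] "3.prems" show ?case by (auto simp: run_Suc step_at fun_upd_def)
next
  case (4 r a b "is" Q R m)
  from "4.IH"[of "pre @ [Sub r a b]"] "4.prems" show ?case by (auto simp: run_Suc step_at fun_upd_def)
next
  case (5 r a "is" Q R m)
  from "5.IH"[of "pre @ [Load r a]"] "5.prems" show ?case by (auto simp: run_Suc step_at fun_upd_def)
next
  case (6 a r "is" Q R m)
  from "6.IH"[of "pre @ [Store a r]"] "6.prems" show ?case by (auto simp: run_Suc step_at fun_upd_def)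
qed auto

lemma valid_Block:
  assumes "\<And>R m. P R m \<Longrightarrow> wp_block is Q R m" "length is \<le> T"
  shows "valid P (Block is) Q T"
  unfolding valid_def
proof (intro allI impI)
  fix pre post R m assume "P R m"
  from run_wp_block[OF assms(1)[OF this], of pre post] assms(2)
  show "\<exists>t\<le>T. \<exists>R' m'. Q R' m' \<and>
      run (pre @ compile (length pre) (Block is) @ post) t \<lparr>pc = length pre, regs = R, mem = m\<rparr>
        = \<lparr>pc = length pre + len (Block is), regs = R', mem = m'\<rparr>"
    by (intro exI[of _ "length is"]) simp
qed

lemma valid_Seq:
  assumes "valid P c Q T" "valid Q d S U"
  shows "valid P (Seq c d) S (T + U)"
  unfolding valid_def
proof (intro allI impI)
  fix pre post R m assume "P R m"
  let ?prog = "pre @ compile (length pre) (Seq c d) @ post"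
  obtain t R' m' where 1: "t \<le> T" "Q R' m'"
    "run ?prog t \<lparr>pc = length pre, regs = R, mem = m\<rparr> = \<lparr>pc = length pre + len c, regs = R', mem = m'\<rparr>"
    by (rule validD[OF assms(1), OF \<open>P R m\<close>, where prog = ?prog and pre = pre and
        a = "length pre" and post = "compile (length pre + len c) d @ post"]) auto
  obtain u R'' m'' where 2: "u \<le> U" "S R'' m''"
    "run ?prog u \<lparr>pc = length pre + len c, regs = R', mem = m'\<rparr>
      = \<lparr>pc = length pre + len c + len d, regs = R'', mem = m''\<rparr>"
    by (rule validD[OF assms(2), OF 1(2), where prog = ?prog and pre = "pre @ compile (length pre) c" and
        a = "length pre + len c" and post = post]) auto
  show "\<exists>t\<le>T + U. \<exists>R' m'. S R' m' \<and> run ?prog t \<lparr>pc = length pre, regs = R, mem = m\<rparr>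
      = \<lparr>pc = length pre + len (Seq c d), regs = R', mem = m'\<rparr>"
    using 1 2 by (intro exI[of _ "t + u"]) (auto simp: run_add add.assoc)
qed

lemma valid_IfNZ:
  assumes "valid (\<lambda>R m. P R m \<and> R r \<noteq> 0) c Q T" "\<And>R m. P R m \<Longrightarrow> R r = 0 \<Longrightarrow> Q R m"
  shows "valid P (IfNZ r c) Q (T + 1)"
  unfolding valid_def
proof (intro allI impI)
  fix pre post R m assume P: "P R m"
  let ?prog = "pre @ compile (length pre) (IfNZ r c) @ post"
  let ?s = "\<lparr>pc = length pre, regs = R, mem = m\<rparr>"
  have st: "step ?prog ?s = exec_instr (Jz r (length pre + len c + 1)) ?s"
    by (rule step_at) auto
  show "\<exists>t\<le>T + 1. \<exists>R' m'. Q R' m' \<and> run ?prog t ?s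
      = \<lparr>pc = length pre + len (IfNZ r c), regs = R', mem = m'\<rparr>"
  proof (cases "R r = 0")
    case True
    then show ?thesis using assms(2)[OF P True] st
      by (intro exI[of _ 1]) (auto simp: run_Suc)
  next
    case False
    with P have "P R m \<and> R r \<noteq> 0" by blast
    then obtain t R' m' where "t \<le> T" "Q R' m'"
      "run ?prog t \<lparr>pc = length pre + 1, regs = R, mem = m\<rparr>
         = \<lparr>pc = length pre + 1 + len c, regs = R', mem = m'\<rparr>"
      by (rule validD[OF assms(1), where prog = ?prog and
          pre = "pre @ [Jz r (length pre + len c + 1)]" and
          a = "length pre + 1" and post = post]) auto
    then show ?thesis using False st
      by (intro exI[of _ "Suc t"]) (auto simp: run_Suc)
  qed
qed

lemma valid_Loop:
  assumes body: "\<And>i. i < N \<Longrightarrow> valid (\<lambda>R m. I i R m \<and> R r = N - i) c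
      (\<lambda>R m. I (Suc i) (R(1 := 1, r := N - Suc i)) m \<and> R r = N - i) T"
    and pre: "\<And>R m. P R m \<Longrightarrow> I 0 R m \<and> R r = N"
    and post: "\<And>R m. I N R m \<Longrightarrow> R r = 0 \<Longrightarrow> Q R m"
    and r: "r \<noteq> 1"
  shows "valid P (Loop r c) Q (N * (T + 4) + 1)"
  unfolding valid_def
proof (intro allI impI)
  fix pre post R m assume P: "P R m"
  define prog where "prog = pre @ compile (length pre) (Loop r c) @ post"
  let ?a = "length pre"
  have jz: "step prog \<lparr>pc = ?a, regs = R, mem = m\<rparr> =
      \<lparr>pc = (if R r = 0 then ?a + len c + 4 else ?a + 1), regs = R, mem = m\<rparr>" for R m
    using step_at[of prog pre "Jz r (?a + len c + 4)"] by (simp add: prog_def)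
  have 1: "step prog \<lparr>pc = ?a + 1 + len c, regs = R, mem = m\<rparr> =
      \<lparr>pc = ?a + len c + 2, regs = R(1 := 1), mem = m\<rparr>" for R m
    using step_at[of prog "pre @ Jz r (?a + len c + 4) # compile (?a + 1) c" "Const 1 1"] by (simp add: prog_def)
  have 2: "step prog \<lparr>pc = ?a + len c + 2, regs = R, mem = m\<rparr> =
      \<lparr>pc = ?a + len c + 3, regs = R(r := R r - R 1), mem = m\<rparr>" for R m
    using step_at[of prog "pre @ Jz r (?a + len c + 4) # compile (?a + 1) c @ [Const 1 1]" "Sub r r 1"]
    by (simp add: prog_def)
  have 3: "step prog \<lparr>pc = ?a + len c + 3, regs = R, mem = m\<rparr> =
      \<lparr>pc = ?a, regs = R, mem = m\<rparr>" for R m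
    using step_at[of prog "pre @ Jz r (?a + len c + 4) # compile (?a + 1) c @ [Const 1 1, Sub r r 1]" "Jmp ?a"]
    by (simp add: prog_def)
  have "\<exists>t\<le>k * (T + 4) + 1. \<exists>R' m'. I N R' m' \<and> R' r = 0 \<and>
      run prog t \<lparr>pc = ?a, regs = R, mem = m\<rparr> = \<lparr>pc = ?a + len c + 4, regs = R', mem = m'\<rparr>"
    if "I (N - k) R m" "R r = k" "k \<le> N" for k R m
    using that
  proof (induction k arbitrary: R m)
    case 0
    then show ?case by (intro exI[of _ 1]) (auto simp: run_Suc jz)
  next
    case (Suc k)
    let ?i = "N - Suc k"
    have "?i < N" using Suc.prems by simp
    have "I ?i R m \<and> R r = N - ?i" using Suc.prems by simp
    then obtain t R' m' where t: "t \<le> T"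
      "I (Suc ?i) (R'(1 := 1, r := N - Suc ?i)) m' \<and> R' r = N - ?i"
      "run prog t \<lparr>pc = ?a + 1, regs = R, mem = m\<rparr>
         = \<lparr>pc = ?a + 1 + len c, regs = R', mem = m'\<rparr>"
      by (rule validD[OF body[OF \<open>?i < N\<close>], where prog = prog and
          pre = "pre @ [Jz r (?a + len c + 4)]" and
          a = "?a + 1" and post = "[Const 1 1, Sub r r 1, Jmp ?a] @ post"])
        (auto simp: prog_def)
    have e: "Suc ?i = N - k" "N - Suc ?i = k" using Suc.prems by auto
    have "I (N - k) (R'(1 := 1, r := k)) m'" using t(2) e by simp
    from Suc.IH[OF this] Suc.prems(3) obtain u R'' m'' where u: "u \<le> k * (T + 4) + 1"
      "I N R'' m'' \<and> R'' r = 0"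
      "run prog u \<lparr>pc = ?a, regs = R'(1 := 1, r := k), mem = m'\<rparr>
         = \<lparr>pc = ?a + len c + 4, regs = R'', mem = m''\<rparr>"
      by (auto simp: fun_upd_def)
    have R'r: "R' r - 1 = k" using t(2) Suc.prems by simp
    have "run prog (Suc (t + Suc (Suc (Suc u)))) \<lparr>pc = ?a, regs = R, mem = m\<rparr>
        = \<lparr>pc = ?a + len c + 4, regs = R'', mem = m''\<rparr>"
      using Suc.prems(2) R'r r
      by (simp only: run_Suc jz run_add nat.simps if_False t(3) 1 2 3 fun_upd_apply
          if_True refl if_cancel u(3) not_False_eq_True)
    then show ?case using t(1) u
      by (intro exI[of _ "Suc (t + Suc (Suc (Suc u)))"]) auto
  qed
  from this[of N R m] pre[OF P]
  obtain t R' m' where "t \<le> N * (T + 4) + 1" "I N R' m'" "R' r = 0"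
      "run prog t \<lparr>pc = ?a, regs = R, mem = m\<rparr> = \<lparr>pc = ?a + len c + 4, regs = R', mem = m'\<rparr>"
    by auto
  then show "\<exists>t\<le>N * (T + 4) + 1. \<exists>R' m'. Q R' m' \<and>
      run (pre @ compile ?a (Loop r c) @ post) t \<lparr>pc = ?a, regs = R, mem = m\<rparr>
      = \<lparr>pc = ?a + len (Loop r c), regs = R', mem = m'\<rparr>"
    using assms(3) by (intro exI[of _ t]) (auto simp: prog_def add.assoc)
qed

section \<open>The greedy subspace\<close>

lemma (in vec_space) rank_le_card_spanning:
  assumes A: "A \<in> carrier_mat n nc" and S: "finite S" "S \<subseteq> carrier_vec n"
    and sub: "set (cols A) \<subseteq> span S"
  shows "rank A \<le> card S"
proof -
  obtain U where U: "maximal U (\<lambda>T. T \<subseteq> set (cols A) \<and> lin_indpt T)"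
    using maximal_exists[of "(\<lambda>T. T \<subseteq> set (cols A) \<and> lin_indpt T)" "card (set (cols A))" "{}"]
    by (meson List.finite_set card_mono empty_iff empty_subsetI finite_lin_indpt2 rev_finite_subset)
  then have U': "U \<subseteq> set (cols A)" "lin_indpt U" by (auto simp: maximal_def)
  then have "finite U" "U \<subseteq> span S" using sub finite_subset by auto
  then obtain C :: "'a vec set" where "int (card C) \<le> int (card S) - int (card U)"
    using replacement[of U S] S U' by auto
  then have "card U \<le> card S" by linarith
  then show ?thesis using rank_card_indpt[OF A U] by simp
qed

lemma bit_neq_0: "(x :: bit) \<noteq> 0 \<longleftrightarrow> x = 1"
  by (cases x) auto

lemma bit_vec_add_self [simp]: "(v :: bit vec) + v = 0\<^sub>v (dim_vec v)"
  by (intro eq_vecI) auto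

locale bit_vec_space = vec_space "TYPE(bit)" n for n
begin

abbreviation "vecs \<equiv> carrier_vec n :: bit vec set"

text \<open>Over two elements an additive map is linear.\<close>

definition additive :: "(bit vec \<Rightarrow> bit vec) \<Rightarrow> bool" where
  "additive \<pi> \<longleftrightarrow> \<pi> \<in> vecs \<rightarrow> vecs \<and> (\<forall>x\<in>vecs. \<forall>y\<in>vecs. \<pi> (x + y) = \<pi> x + \<pi> y)"

lemma additiveD:
  assumes "additive \<pi>" "x \<in> vecs"
  shows "\<pi> x \<in> vecs" "y \<in> vecs \<Longrightarrow> \<pi> (x + y) = \<pi> x + \<pi> y"
  using assms unfolding additive_def by auto

lemma bit_add_eq_0_iff:
  assumes "x \<in> vecs" "y \<in> vecs"
  shows "x + y = 0\<^sub>v n \<longleftrightarrow> x = y"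
proof
  assume *: "x + y = 0\<^sub>v n"
  have "x $ i = y $ i" if "i < n" for i
  proof -
    have "(x + y) $ i = 0" using * that by simp
    then have "x $ i + y $ i = 0" using assms that by simp
    then show ?thesis by (cases "x $ i"; cases "y $ i") auto
  qed
  then show "x = y" using assms by (intro eq_vecI) auto
qed (use assms in auto)

lemma additive_0:
  assumes "additive \<pi>"
  shows "\<pi> (0\<^sub>v n) = 0\<^sub>v n"
proof -
  have "\<pi> (0\<^sub>v n) = \<pi> (0\<^sub>v n) + \<pi> (0\<^sub>v n)"
    using additiveD(2)[OF assms, of "0\<^sub>v n" "0\<^sub>v n"] by simp
  then show ?thesis using additiveD(1)[OF assms, of "0\<^sub>v n"] by simp
qed

definition ker :: "(bit vec \<Rightarrow> bit vec) \<Rightarrow> bit vec set" where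
  "ker \<pi> = {x \<in> vecs. \<pi> x = 0\<^sub>v n}"

lemma submodule_ker:
  assumes "additive \<pi>"
  shows "submodule class_ring (ker \<pi>) (module_vec TYPE(bit) n)"
proof (unfold_locales)
  fix c :: bit and x assume x: "x \<in> ker \<pi>"
  show "c \<odot>\<^bsub>V\<^esub> x \<in> ker \<pi>"
    using x additive_0[OF assms] by (cases c) (auto simp: ker_def)
qed (use additive_0[OF assms] additiveD[OF assms] in \<open>auto simp: ker_def\<close>)

lemma span_subset_ker:
  assumes "additive \<pi>" "S \<subseteq> ker \<pi>"
  shows "span S \<subseteq> ker \<pi>"
  using span_is_subset[OF assms(2) submodule_ker[OF assms(1)]] .

text \<open>\<open>\<pi>'\<close> is \<open>\<pi>\<close> followed by the quotient map by \<open>\<pi> v\<close>.\<close>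

definition kills :: "(bit vec \<Rightarrow> bit vec) \<Rightarrow> bit vec \<Rightarrow> (bit vec \<Rightarrow> bit vec) \<Rightarrow> bool" where
  "kills \<pi> v \<pi>' \<longleftrightarrow> additive \<pi>' \<and> (\<forall>x\<in>vecs. \<pi>' x = 0\<^sub>v n \<longleftrightarrow> \<pi> x = 0\<^sub>v n \<or> \<pi> x = \<pi> v)"

definition reduced :: "nat \<Rightarrow> (nat \<Rightarrow> bit vec) \<Rightarrow> (nat \<Rightarrow> bit vec) \<Rightarrow> bool" where
  "reduced r A A' \<longleftrightarrow>
     A r = 0\<^sub>v n \<and> (\<forall>j\<le>r. A' j = A j) \<or>
     (\<exists>p<n. A r $ p \<noteq> 0 \<and> (\<forall>j\<le>r. A' j = (if A j $ p \<noteq> 0 then A j + A r else A j)))"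

lemma reduced_kills:
  assumes \<pi>: "additive \<pi>" and f: "\<And>j. j \<le> r \<Longrightarrow> f j \<in> vecs" and A: "\<And>j. j \<le> r \<Longrightarrow> A j = \<pi> (f j)"
    and red: "reduced r A A'"
  obtains \<pi>' where "kills \<pi> (f r) \<pi>'" "\<And>j. j \<le> r \<Longrightarrow> A' j = \<pi>' (f j)"
  using red unfolding reduced_def
proof (elim disjE exE conjE)
  assume 0: "A r = 0\<^sub>v n" and A': "\<forall>j\<le>r. A' j = A j"
  show ?thesis
    by (rule that[of \<pi>]) (use 0 A' A \<pi> in \<open>auto simp: kills_def\<close>)
next
  fix p assume p: "p < n" "A r $ p \<noteq> 0"
    and A': "\<forall>j\<le>r. A' j = (if A j $ p \<noteq> 0 then A j + A r else A j)"
  define v where "v = A r"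
  have v: "v \<in> vecs" "v = \<pi> (f r)" "v $ p = 1"
    using A[of r] additiveD(1)[OF \<pi> f[of r]] p by (auto simp: v_def bit_neq_0)
  define \<pi>' where "\<pi>' x = (if \<pi> x $ p \<noteq> 0 then \<pi> x + v else \<pi> x)" for x
  have "\<pi>' (x + y) = \<pi>' x + \<pi>' y" if "x \<in> vecs" "y \<in> vecs" for x y
  proof -
    have xy: "\<pi> x \<in> vecs" "\<pi> y \<in> vecs" "\<pi> (x + y) = \<pi> x + \<pi> y"
      using additiveD[OF \<pi>] that by auto
    show ?thesis
    proof (intro eq_vecI)
      fix i assume "i < dim_vec (\<pi>' x + \<pi>' y)"
      then have i: "i < n" using xy v by (simp add: \<pi>'_def split: if_splits)
      show "\<pi>' (x + y) $ i = (\<pi>' x + \<pi>' y) $ i"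
        using i xy v p(1)
        by (cases "\<pi> x $ p"; cases "\<pi> y $ p"; cases "v $ i") (simp_all add: \<pi>'_def)
    qed (use xy v in \<open>simp add: \<pi>'_def\<close>)
  qed
  then have add: "additive \<pi>'"
    using additiveD[OF \<pi>] v by (auto simp: additive_def \<pi>'_def)
  have "\<pi>' x = 0\<^sub>v n \<longleftrightarrow> \<pi> x = 0\<^sub>v n \<or> \<pi> x = \<pi> (f r)" if "x \<in> vecs" for x
    using that additiveD(1)[OF \<pi> that] v p bit_add_eq_0_iff[of "\<pi> x" v]
    by (auto simp: \<pi>'_def)
  with add have "kills \<pi> (f r) \<pi>'" by (simp add: kills_def)
  then show ?thesis
    by (rule that) (use A A' in \<open>auto simp: \<pi>'_def v_def\<close>)
qed

definition kernel_small :: "nat \<Rightarrow> (bit vec \<Rightarrow> bit vec) \<Rightarrow> bool" where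
  "kernel_small s \<pi> \<longleftrightarrow> (\<exists>S. finite S \<and> S \<subseteq> vecs \<and> card S \<le> s \<and> ker \<pi> \<subseteq> span S)"

text \<open>\<open>I\<close> collects the columns at which both candidates were divided out. The kernel bound yields the
  upper estimate, the independence of every choice of candidates over \<open>I\<close> the lower one.\<close>

definition progress :: "(nat \<Rightarrow> bit vec) \<Rightarrow> (nat \<Rightarrow> bit vec) \<Rightarrow> nat \<Rightarrow> nat \<Rightarrow> (bit vec \<Rightarrow> bit vec) \<Rightarrow> bool" where
  "progress a b K s \<pi> \<longleftrightarrow> additive \<pi> \<and> kernel_small (2 * s) \<pi> \<and>
     (\<forall>k. K \<le> k \<and> k < n \<longrightarrow> \<pi> (a k) = 0\<^sub>v n \<or> \<pi> (b k) = 0\<^sub>v n) \<and>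
     (\<exists>I\<subseteq>{K..<n}. card I = s \<and> (\<forall>k\<in>I. \<pi> (a k) = 0\<^sub>v n \<and> \<pi> (b k) = 0\<^sub>v n) \<and>
        (\<forall>y. (\<forall>k\<in>I. y k \<in> {a k, b k}) \<longrightarrow> inj_on y I \<and> lin_indpt (y ` I)))"

lemma progress_init: "progress a b n 0 id"
proof -
  have "additive id" by (auto simp: additive_def)
  moreover have "ker id \<subseteq> span {}"
    unfolding span_empty by (auto simp: ker_def)
  then have "kernel_small 0 id"
    unfolding kernel_small_def by (intro exI[of _ "{}"]) auto
  moreover have "lin_indpt {}" unfolding lin_dep_def by blast
  ultimately show ?thesis unfolding progress_def by (auto intro!: exI[of _ "{}"])
qed

lemma progress_skip:
  assumes "progress a b (Suc K) s \<pi>" "\<pi> (a K) = 0\<^sub>v n \<or> \<pi> (b K) = 0\<^sub>v n"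
  shows "progress a b K s \<pi>"
proof -
  obtain I where I: "I \<subseteq> {Suc K..<n}" "card I = s"
      "\<forall>k\<in>I. \<pi> (a k) = 0\<^sub>v n \<and> \<pi> (b k) = 0\<^sub>v n"
      "\<forall>y. (\<forall>k\<in>I. y k \<in> {a k, b k}) \<longrightarrow> inj_on y I \<and> lin_indpt (y ` I)"
    using assms(1) unfolding progress_def by blast
  have "\<forall>k. K \<le> k \<and> k < n \<longrightarrow> \<pi> (a k) = 0\<^sub>v n \<or> \<pi> (b k) = 0\<^sub>v n"
    using assms unfolding progress_def by (metis le_antisym not_less_eq_eq)
  moreover have "I \<subseteq> {K..<n}" using I(1) by auto
  ultimately show ?thesis
    using assms(1) I(2-4) unfolding progress_def by blast
qed

lemma kernel_small_kills:
  assumes \<pi>: "additive \<pi>" and "kernel_small s \<pi>" "kills \<pi> v \<pi>'" "v \<in> vecs"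
  shows "kernel_small (Suc s) \<pi>'"
proof -
  obtain S where S: "finite S" "S \<subseteq> vecs" "card S \<le> s" "ker \<pi> \<subseteq> span S"
    using assms(2) unfolding kernel_small_def by blast
  let ?S = "insert v S"
  have S': "?S \<subseteq> vecs" using S assms(4) by auto
  have mono: "span S \<subseteq> span ?S" by (intro span_is_monotone) auto
  have vS: "v \<in> span ?S" using in_own_span[of ?S] S' by auto
  have "x \<in> span ?S" if "x \<in> ker \<pi>'" for x
  proof -
    have x: "x \<in> vecs" "\<pi> x = 0\<^sub>v n \<or> \<pi> x = \<pi> v"
      using that assms(3) by (auto simp: ker_def kills_def)
    show ?thesis
    proof (cases "\<pi> x = 0\<^sub>v n")
      case True
      then show ?thesis using x S(4) mono by (auto simp: ker_def)
    next
      case False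
      then have "\<pi> (v + x) = 0\<^sub>v n"
        using x additiveD[OF \<pi> assms(4)] by (metis bit_add_eq_0_iff)
      then have "v + x \<in> span ?S" using x S(4) mono assms(4) by (auto simp: ker_def)
      then show ?thesis using span_add[OF _ vS, of x] S' x by auto
    qed
  qed
  moreover have "card ?S \<le> Suc s" using S by (simp add: card_insert_if)
  ultimately show ?thesis unfolding kernel_small_def
    using S(1) S' by (intro exI[of _ ?S]) auto
qed

context
  fixes a b :: "nat \<Rightarrow> bit vec"
  assumes ab: "\<And>k. k < n \<Longrightarrow> a k \<in> vecs" "\<And>k. k < n \<Longrightarrow> b k \<in> vecs"
begin

lemma progress_step:
  assumes pr: "progress a b (Suc K) s \<pi>" and K: "K < n"
    and nz: "\<pi> (a K) \<noteq> 0\<^sub>v n" "\<pi> (b K) \<noteq> 0\<^sub>v n"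
    and k1: "kills \<pi> (b K) \<pi>1" and k2: "kills \<pi>1 (a K) \<pi>2"
  shows "progress a b K (Suc s) \<pi>2"
proof -
  have \<pi>: "additive \<pi>" "additive \<pi>1" "additive \<pi>2"
    using pr k1 k2 by (auto simp: progress_def kills_def)
  have "kernel_small (2 * s) \<pi>" using pr by (simp add: progress_def)
  from kernel_small_kills[OF \<pi>(2) kernel_small_kills[OF \<pi>(1) this k1 ab(2)[OF K]] k2 ab(1)[OF K]]
  have small: "kernel_small (2 * Suc s) \<pi>2" by simp
  have mono: "\<pi>2 x = 0\<^sub>v n" if "x \<in> vecs" "\<pi> x = 0\<^sub>v n" for x
    using that k1 k2 by (simp add: kills_def)
  have new: "\<pi>2 (a K) = 0\<^sub>v n" "\<pi>2 (b K) = 0\<^sub>v n"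
    using k1 k2 ab[OF K] by (auto simp: kills_def)
  have all: "\<forall>k. K \<le> k \<and> k < n \<longrightarrow> \<pi>2 (a k) = 0\<^sub>v n \<or> \<pi>2 (b k) = 0\<^sub>v n"
  proof (intro allI impI)
    fix k assume k: "K \<le> k \<and> k < n"
    show "\<pi>2 (a k) = 0\<^sub>v n \<or> \<pi>2 (b k) = 0\<^sub>v n"
    proof (cases "k = K")
      case False
      then have "\<pi> (a k) = 0\<^sub>v n \<or> \<pi> (b k) = 0\<^sub>v n"
        using k pr unfolding progress_def by (metis Suc_leI le_neq_implies_less)
      then show ?thesis using mono ab k by blast
    qed (use new in auto)
  qed
  obtain I where I: "I \<subseteq> {Suc K..<n}" "card I = s"
      "\<forall>k\<in>I. \<pi> (a k) = 0\<^sub>v n \<and> \<pi> (b k) = 0\<^sub>v n"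
      "\<forall>y. (\<forall>k\<in>I. y k \<in> {a k, b k}) \<longrightarrow> inj_on y I \<and> lin_indpt (y ` I)"
    using pr unfolding progress_def by (elim exE conjE) (rule that)
  have fin: "finite I" "K \<notin> I" using I(1) finite_subset by auto
  have "inj_on y (insert K I) \<and> lin_indpt (y ` insert K I)"
    if y: "\<forall>k\<in>insert K I. y k \<in> {a k, b k}" for y
  proof -
    have old: "inj_on y I" "lin_indpt (y ` I)" using I(4) y by auto
    have yI: "y ` I \<subseteq> ker \<pi>"
    proof
      fix x assume "x \<in> y ` I"
      then obtain k where "k \<in> I" "x = y k" by blast
      then show "x \<in> ker \<pi>" using y I(1,3) ab[of k] by (force simp: ker_def)
    qed
    have yK: "y K \<in> vecs" "y K \<notin> ker \<pi>" using y ab[OF K] nz by (auto simp: ker_def)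
    have "y K \<notin> span (y ` I)" using span_subset_ker[OF \<pi>(1) yI] yK by auto
    moreover have "y ` I \<subseteq> vecs" using yI by (auto simp: ker_def)
    ultimately have "lin_indpt (insert (y K) (y ` I))"
      using lin_dep_iff_in_span[of "y ` I" "y K"] old(2) yK yI by auto
    then show ?thesis using old(1) yI yK by auto
  qed
  moreover have "insert K I \<subseteq> {K..<n}" "card (insert K I) = Suc s"
    using I(1,2) fin K by auto
  moreover have "\<forall>k\<in>insert K I. \<pi>2 (a k) = 0\<^sub>v n \<and> \<pi>2 (b k) = 0\<^sub>v n"
    using I(1,3) mono new ab by (auto simp: subset_iff)
  ultimately show ?thesis unfolding progress_def using \<pi>(3) small all by blast
qed

end

lemma minrank_diag_bounds:
  assumes M: "M \<in> carrier_mat n n"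
    and pr: "progress (col M) (\<lambda>k. col M k + unit_vec n k) 0 s \<pi>"
  shows "minrank_diag n M \<le> 2 * s \<and> s \<le> minrank_diag n M"
proof
  define Q where "Q r \<longleftrightarrow> (\<exists>D. D \<in> carrier_mat n n \<and> diagonal_mat D \<and> r = rank (M + D))" for r
  have mr: "minrank_diag n M = (LEAST r. Q r)" by (simp add: minrank_diag_def Q_def)
  have ab: "col M k \<in> vecs" "col M k + unit_vec n k \<in> vecs" if "k < n" for k
    using M that by auto
  define D where "D = mat n n (\<lambda>(i, j). if i = j \<and> \<pi> (col M j) \<noteq> 0\<^sub>v n then 1 else (0 :: bit))"
  have D: "D \<in> carrier_mat n n" "diagonal_mat D" by (auto simp: D_def diagonal_mat_def)
  have MD: "M + D \<in> carrier_mat n n" using M D by simp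
  have colD: "col (M + D) k = (if \<pi> (col M k) \<noteq> 0\<^sub>v n then col M k + unit_vec n k else col M k)"
    if "k < n" for k
    using that M by (intro eq_vecI) (auto simp: D_def)
  obtain S where S: "finite S" "S \<subseteq> vecs" "card S \<le> 2 * s" "ker \<pi> \<subseteq> span S"
    using pr unfolding progress_def kernel_small_def by blast
  have "col (M + D) k \<in> ker \<pi>" if "k < n" for k
    using pr that ab[OF that] colD[OF that] unfolding progress_def by (auto simp: ker_def)
  then have "set (cols (M + D)) \<subseteq> span S" using S(4) D(1) by (auto simp: cols_def)
  from rank_le_card_spanning[OF MD S(1,2) this] S(3) have "rank (M + D) \<le> 2 * s" by simp
  moreover have "Q (rank (M + D))" using D by (auto simp: Q_def)
  ultimately show "minrank_diag n M \<le> 2 * s" unfolding mr by (meson Least_le order_trans)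
  have "s \<le> r" if "Q r" for r
  proof -
    obtain D where D: "D \<in> carrier_mat n n" "diagonal_mat D" and r: "r = rank (M + D)"
      using \<open>Q r\<close> unfolding Q_def by (elim exE conjE) (rule that)
    obtain I where I: "I \<subseteq> {0..<n}" "card I = s"
      "\<forall>y. (\<forall>k\<in>I. y k \<in> {col M k, col M k + unit_vec n k}) \<longrightarrow> inj_on y I \<and> lin_indpt (y ` I)"
      using pr unfolding progress_def by (elim exE conjE) (rule that)
    have "col (M + D) k \<in> {col M k, col M k + unit_vec n k}" if "k \<in> I" for k
    proof -
      have k: "k < n" using that I(1) by auto
      have off: "D $$ (i, k) = 0" if "i < n" "i \<noteq> k" for i
        using D k that by (simp add: diagonal_mat_def)
      have "col (M + D) k = (if D $$ (k, k) = 0 then col M k else col M k + unit_vec n k)" (is "_ = ?v")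
      proof (rule eq_vecI)
        fix i assume "i < dim_vec ?v"
        then have i: "i < n" using M by (simp split: if_splits)
        show "col (M + D) k $ i = ?v $ i"
          using i k M D(1) off[OF i] by (cases "i = k"; cases "D $$ (k, k)") simp_all
      qed (use M D(1) in simp)
      then show ?thesis by simp
    qed
    then have *: "inj_on (col (M + D)) I" "lin_indpt (col (M + D) ` I)" using I(3) by auto
    have MD: "M + D \<in> carrier_mat n n" using M D by simp
    have "col (M + D) ` I \<subseteq> set (cols (M + D))" using I(1) D(1) by (auto simp: cols_def)
    from rank_ge_card_indpt[OF MD this *(2)] show ?thesis
      using card_image[OF *(1)] I(2) r by simp
  qed
  then show "s \<le> minrank_diag n M"
    unfolding mr using LeastI[of Q, OF \<open>Q (rank (M + D))\<close>] by this
qed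

end

section \<open>Elimination on the machine\<close>

text \<open>Row \<open>j\<close> of the working table starts at address \<open>n * n + j * n\<close>, just behind the input.\<close>

definition tab :: "nat \<Rightarrow> nat \<Rightarrow> (nat \<Rightarrow> nat) \<Rightarrow> (nat \<Rightarrow> nat \<Rightarrow> bit) \<Rightarrow> bool" where
  "tab n q m T \<longleftrightarrow> (\<forall>j<q. \<forall>c<n. m (n * n + j * n + c) = bit_val (T j c))"

lemma tabD: "tab n q m T \<Longrightarrow> j < q \<Longrightarrow> c < n \<Longrightarrow> m (n * n + j * n + c) = bit_val (T j c)"
  by (simp add: tab_def)

lemma row_col_inject:
  fixes n :: nat
  assumes "c < n" "c' < n"
  shows "j * n + c = i * n + c' \<longleftrightarrow> j = i \<and> c = c'"
proof
  assume *: "j * n + c = i * n + c'"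
  have "(j * n + c) div n = j" "(i * n + c') div n = i" using assms by auto
  with * show "j = i \<and> c = c'" by auto
qed auto

lemma tab_upd:
  assumes "tab n q m T" "c < n"
  shows "tab n q (m(n * n + i * n + c := bit_val v)) (T(i := (T i)(c := v)))"
  using assms row_col_inject[OF _ assms(2)] by (auto simp: tab_def)

lemma tab_cong:
  assumes "tab n q m T" "q' \<le> q" "\<And>j c. j < q' \<Longrightarrow> c < n \<Longrightarrow> T j c = T' j c"
  shows "tab n q' m T'"
  using assms by (auto simp: tab_def)

lemma bit_val_simps [simp]: "bit_val 0 = 0" "bit_val 1 = 1" "bit_val x = 0 \<longleftrightarrow> x = 0"
  by (auto simp: bit_val_def bit_neq_0)

lemma bit_val_add: "bit_val x - bit_val y + (bit_val y - bit_val x) = bit_val (x + y)"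
  by (cases x; cases y) auto

lemma bit_val_flip: "Suc 0 - bit_val x = bit_val (of_bool (x = 0))"
  by (cases x) auto

text \<open>Registers: 0 holds \<open>n\<close>, 1 is clobbered by every loop, 2 holds \<open>n * n\<close>, 3 counts the remaining
  columns, 4 stays 0 so that \<open>Add r a 4\<close> copies, 5 points to the current row, 12 holds the result,
  13 the number of live rows; the others are temporary.\<close>

definition add_row :: com where
  "add_row = Seq (Block [Add 8 0 4, Add 7 5 4])
    (Seq (Loop 8 (Block [Load 10 20, Load 11 7, Sub 14 10 11, Sub 11 11 10, Add 10 14 11,
                         Store 20 10, Const 11 1, Add 20 20 11, Add 7 7 11]))
         (Block [Sub 20 20 0]))"

definition process_row :: com where
  "process_row = Seq (Block [Add 9 20 18, Load 9 9]) (Seq (IfNZ 9 add_row) (Block [Add 20 20 0]))"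

definition process_rows :: com where
  "process_rows = Seq (Block [Add 19 13 4, Add 20 2 4]) (Loop 19 process_row)"

text \<open>Rows are updated upwards and the pivot row is the last live row, so it is intact until it is
  finally added to itself. After that it is zero and the later columns tried as pivots have no effect;
  hence the loop in \<open>elim\<close> needs no early exit.\<close>

definition pivot :: com where
  "pivot = Seq (Block [Add 9 5 18, Load 9 9])
             (Seq (IfNZ 9 process_rows) (Block [Const 11 1, Add 18 18 11]))"

definition elim :: com where
  "elim = Seq (Block [Add 16 0 4, Const 18 0]) (Loop 16 pivot)"

definition row_sum :: com where
  "row_sum = Seq (Block [Const 14 0, Add 8 0 4])
     (Loop 8 (Block [Load 9 7, Add 14 14 9, Const 11 1, Add 7 7 11]))"

definition env :: "nat \<Rightarrow> nat \<Rightarrow> nat \<Rightarrow> nat \<Rightarrow> nat \<Rightarrow> (nat \<Rightarrow> nat) \<Rightarrow> bool" where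
  "env n u w b q R \<longleftrightarrow>
     R 0 = n \<and> R 2 = n * n \<and> R 3 = u \<and> R 4 = 0 \<and> R 5 = b \<and> R 12 = w \<and> R 13 = q"

lemma valid_add_row:
  assumes r: "i \<le> r"
  shows "valid
    (\<lambda>R m. env n u w (n * n + r * n) (Suc r) R \<and> R 16 = x \<and> R 18 = p \<and> R 19 = y \<and>
           R 20 = n * n + i * n \<and> tab n (Suc r) m T)
    add_row
    (\<lambda>R m. env n u w (n * n + r * n) (Suc r) R \<and> R 16 = x \<and> R 18 = p \<and> R 19 = y \<and>
           R 20 = n * n + i * n \<and> tab n (Suc r) m (T(i := \<lambda>c. T i c + T r c)))
    (13 * n + 4)"
proof -
  define T' where "T' k = T(i := \<lambda>c. if c < k then T i c + T r c else T i c)" for k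
  define I where "I k R m \<longleftrightarrow> env n u w (n * n + r * n) (Suc r) R \<and> R 16 = x \<and> R 18 = p \<and> R 19 = y \<and>
           R 20 = n * n + i * n + k \<and> R 7 = n * n + r * n + k \<and> tab n (Suc r) m (T' k)" for k R m
  have T'_Suc: "T' (Suc k) = (T' k)(i := (T' k i)(k := T i k + T r k))" for k
    by (auto simp: T'_def fun_eq_iff)
  have T'_k: "T' k i k = T i k" "T' k r k = T r k" for k by (auto simp: T'_def)
  have 1: "valid (\<lambda>R m. env n u w (n * n + r * n) (Suc r) R \<and> R 16 = x \<and> R 18 = p \<and> R 19 = y \<and>
           R 20 = n * n + i * n \<and> tab n (Suc r) m T)
      (Block [Add 8 0 4, Add 7 5 4]) (\<lambda>R m. I 0 R m \<and> R 8 = n) 2"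
    by (rule valid_Block) (auto simp: I_def env_def T'_def)
  have 2: "valid (\<lambda>R m. I 0 R m \<and> R 8 = n)
      (Loop 8 (Block [Load 10 20, Load 11 7, Sub 14 10 11, Sub 11 11 10, Add 10 14 11,
                         Store 20 10, Const 11 1, Add 20 20 11, Add 7 7 11])) (I n) (n * (9 + 4) + 1)"
  proof (rule valid_Loop[where I = I])
    fix k assume k: "k < n"
    show "valid (\<lambda>R m. I k R m \<and> R 8 = n - k)
      (Block [Load 10 20, Load 11 7, Sub 14 10 11, Sub 11 11 10, Add 10 14 11,
                         Store 20 10, Const 11 1, Add 20 20 11, Add 7 7 11])
      (\<lambda>R m. I (Suc k) (R(1 := 1, 8 := n - Suc k)) m \<and> R 8 = n - k) 9"
    proof (rule valid_Block)
      fix R m assume *: "I k R m \<and> R 8 = n - k"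
      have tb: "tab n (Suc r) m (T' k)" using * by (simp add: I_def)
      have "m (n * n + i * n + k) = bit_val (T i k)" "m (n * n + r * n + k) = bit_val (T r k)"
        using tabD[OF tb _ k, of i] tabD[OF tb _ k, of r] r by (simp_all add: T'_k)
      then show "wp_block [Load 10 20, Load 11 7, Sub 14 10 11, Sub 11 11 10, Add 10 14 11,
                         Store 20 10, Const 11 1, Add 20 20 11, Add 7 7 11]
        (\<lambda>R m. I (Suc k) (R(1 := 1, 8 := n - Suc k)) m \<and> R 8 = n - k) R m"
        using * tab_upd[OF tb k, of i "T i k + T r k"]
        by (simp add: I_def env_def bit_val_add T'_Suc)
    qed simp
  qed auto
  have 3: "valid (I n) (Block [Sub 20 20 0])
     (\<lambda>R m. env n u w (n * n + r * n) (Suc r) R \<and> R 16 = x \<and> R 18 = p \<and> R 19 = y \<and>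
           R 20 = n * n + i * n \<and> tab n (Suc r) m (T(i := \<lambda>c. T i c + T r c))) 1"
    by (rule valid_Block) (auto simp: I_def env_def T'_def elim!: tab_cong)
  show ?thesis
    unfolding add_row_def by (rule valid_conseq[OF valid_Seq[OF 1 valid_Seq[OF 2 3]]]) auto
qed

lemma valid_process_rows:
  assumes r: "Suc r \<le> 2 * n" and p: "p < n"
  shows "valid
    (\<lambda>R m. env n u w (n * n + r * n) (Suc r) R \<and> R 16 = x \<and> R 18 = p \<and> tab n (Suc r) m T)
    process_rows
    (\<lambda>R m. env n u w (n * n + r * n) (Suc r) R \<and> R 16 = x \<and> R 18 = p \<and>
       tab n (Suc r) m (\<lambda>j c. if T j p \<noteq> 0 then T j c + T r c else T j c))
    (26 * n * n + 24 * n + 3)"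
proof -
  define T' where "T' i = (\<lambda>j c. if j < i \<and> T j p \<noteq> 0 then T j c + T r c else T j c)" for i
  define I where "I i R m \<longleftrightarrow> env n u w (n * n + r * n) (Suc r) R \<and> R 16 = x \<and> R 18 = p \<and>
     R 20 = n * n + i * n \<and> tab n (Suc r) m (T' i)" for i R m
  have 1: "valid (\<lambda>R m. env n u w (n * n + r * n) (Suc r) R \<and> R 16 = x \<and> R 18 = p \<and> tab n (Suc r) m T)
      (Block [Add 19 13 4, Add 20 2 4]) (\<lambda>R m. I 0 R m \<and> R 19 = Suc r) 2"
    by (rule valid_Block) (auto simp: I_def env_def T'_def)
  have 2: "valid (\<lambda>R m. I 0 R m \<and> R 19 = Suc r) (Loop 19 process_row) (I (Suc r))
      (Suc r * ((13 * n + 8) + 4) + 1)"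
  proof (rule valid_Loop[where I = I])
    fix i assume i: "i < Suc r"
    have T'i: "T' i i = T i" "T' i r = T r" using i by (auto simp: T'_def)
    let ?J = "\<lambda>T' R m. env n u w (n * n + r * n) (Suc r) R \<and> R 16 = x \<and> R 18 = p \<and>
       R 19 = Suc r - i \<and> R 20 = n * n + i * n \<and> tab n (Suc r) m T'"
    have a: "valid (\<lambda>R m. I i R m \<and> R 19 = Suc r - i) (Block [Add 9 20 18, Load 9 9])
        (\<lambda>R m. ?J (T' i) R m \<and> R 9 = bit_val (T i p)) 2"
    proof (rule valid_Block)
      fix R m assume *: "I i R m \<and> R 19 = Suc r - i"
      then have "m (n * n + i * n + p) = bit_val (T i p)"
        using tabD[of n "Suc r" m "T' i" i p] i p by (simp add: I_def T'i)
      with * show "wp_block [Add 9 20 18, Load 9 9] (\<lambda>R m. ?J (T' i) R m \<and> R 9 = bit_val (T i p)) R m"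
        by (simp add: I_def env_def)
    qed simp
    have b: "valid (\<lambda>R m. ?J (T' i) R m \<and> R 9 = bit_val (T i p)) (IfNZ 9 add_row)
       (?J (T' (Suc i))) ((13 * n + 4) + 1)"
    proof (rule valid_IfNZ)
      show "valid (\<lambda>R m. (?J (T' i) R m \<and> R 9 = bit_val (T i p)) \<and> R 9 \<noteq> 0) add_row
         (?J (T' (Suc i))) (13 * n + 4)"
      proof (cases "T i p = 0")
        case False
        then have "T' (Suc i) = (T' i)(i := \<lambda>c. T' i i c + T' i r c)"
          using i by (auto simp: T'_def fun_eq_iff less_Suc_eq)
        then show ?thesis
          by (intro valid_conseq[OF valid_add_row[of i r n u w x p "Suc r - i" "T' i"]])
             (use i in auto)
      qed (auto simp: valid_def)
      fix R m assume *: "?J (T' i) R m \<and> R 9 = bit_val (T i p)" "R 9 = 0"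
      then have "T' (Suc i) = T' i" by (auto simp: T'_def fun_eq_iff less_Suc_eq)
      with * show "?J (T' (Suc i)) R m" by simp
    qed
    have c: "valid (?J (T' (Suc i))) (Block [Add 20 20 0])
        (\<lambda>R m. I (Suc i) (R(1 := 1, 19 := Suc r - Suc i)) m \<and> R 19 = Suc r - i) 1"
      by (rule valid_Block) (auto simp: I_def env_def)
    show "valid (\<lambda>R m. I i R m \<and> R 19 = Suc r - i) process_row
        (\<lambda>R m. I (Suc i) (R(1 := 1, 19 := Suc r - Suc i)) m \<and> R 19 = Suc r - i) (13 * n + 8)"
      unfolding process_row_def by (rule valid_conseq[OF valid_Seq[OF a valid_Seq[OF b c]]]) auto
  qed auto
  have "Suc r * ((13 * n + 8) + 4) \<le> 2 * n * (13 * n + 12)"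
    by (intro mult_mono) (use r in auto)
  then have time: "2 + (Suc r * ((13 * n + 8) + 4) + 1) \<le> 26 * n * n + 24 * n + 3"
    by (simp add: algebra_simps)
  show ?thesis
    unfolding process_rows_def
    by (rule valid_conseq[OF valid_Seq[OF 1 2]])
       (use time in \<open>auto simp: I_def T'_def elim!: tab_cong\<close>)
qed

definition pivoted :: "nat \<Rightarrow> nat \<Rightarrow> nat \<Rightarrow> (nat \<Rightarrow> nat \<Rightarrow> bit) \<Rightarrow> (nat \<Rightarrow> nat \<Rightarrow> bit) \<Rightarrow> bool" where
  "pivoted n r p T T' \<longleftrightarrow>
     (\<forall>c<p. T r c = 0) \<and> (\<forall>j\<le>r. \<forall>c<n. T' j c = T j c) \<or>
     (\<exists>p'<p. T r p' \<noteq> 0 \<and>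
        (\<forall>j\<le>r. \<forall>c<n. T' j c = (if T j p' \<noteq> 0 then T j c + T r c else T j c)))"

lemma pivoted_skip:
  assumes "pivoted n r p T T'" "T' r p = 0" "p < n"
  shows "pivoted n r (Suc p) T T'"
  using assms by (auto simp: pivoted_def less_Suc_eq)

lemma pivoted_step:
  assumes "pivoted n r p T T'" "T' r p \<noteq> 0" "p < n"
  shows "pivoted n r (Suc p) T (\<lambda>j c. if T' j p \<noteq> 0 then T' j c + T' r c else T' j c)"
  using assms(1)[unfolded pivoted_def]
proof (elim disjE exE conjE)
  fix p' assume p': "T r p' \<noteq> 0"
    "\<forall>j\<le>r. \<forall>c<n. T' j c = (if T j p' \<noteq> 0 then T j c + T r c else T j c)"
  then have "T' r p = 0" using assms(3) by simp
  then show ?thesis using assms(2) by simp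
next
  assume "\<forall>j\<le>r. \<forall>c<n. T' j c = T j c"
  then show ?thesis using assms(2,3)
    unfolding pivoted_def by (intro disjI2 exI[of _ p]) auto
qed

lemma valid_elim:
  assumes r: "Suc r \<le> 2 * n"
  shows "valid
    (\<lambda>R m. env n u w (n * n + r * n) (Suc r) R \<and> tab n (Suc r) m T)
    elim
    (\<lambda>R m. env n u w (n * n + r * n) (Suc r) R \<and> (\<exists>T'. tab n (Suc r) m T' \<and> pivoted n r n T T'))
    (26 * n * n * n + 24 * n * n + 12 * n + 3)"
proof -
  let ?J = "\<lambda>p i T' R m. env n u w (n * n + r * n) (Suc r) R \<and> R 16 = n - i \<and> R 18 = i \<and>
       tab n (Suc r) m T' \<and> pivoted n r p T T'"
  define I where "I p R m \<longleftrightarrow> env n u w (n * n + r * n) (Suc r) R \<and> R 18 = p \<and>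
       (\<exists>T'. tab n (Suc r) m T' \<and> pivoted n r p T T')" for p R m
  have 1: "valid (\<lambda>R m. env n u w (n * n + r * n) (Suc r) R \<and> tab n (Suc r) m T)
      (Block [Add 16 0 4, Const 18 0]) (\<lambda>R m. I 0 R m \<and> R 16 = n) 2"
    by (rule valid_Block) (auto simp: I_def env_def pivoted_def)
  have 2: "valid (\<lambda>R m. I 0 R m \<and> R 16 = n) (Loop 16 pivot) (I n)
      (n * ((26 * n * n + 24 * n + 8) + 4) + 1)"
  proof (rule valid_Loop[where I = I])
    fix p assume p: "p < n"
    have body: "valid (?J p p T') pivot
        (\<lambda>R m. I (Suc p) (R(1 := 1, 16 := n - Suc p)) m \<and> R 16 = n - p) (26 * n * n + 24 * n + 8)" for T'
    proof -
      have a: "valid (?J p p T') (Block [Add 9 5 18, Load 9 9])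
          (\<lambda>R m. ?J p p T' R m \<and> R 9 = bit_val (T' r p)) 2"
      proof (rule valid_Block)
        fix R m assume *: "?J p p T' R m"
        then have "m (n * n + r * n + p) = bit_val (T' r p)" using p by (intro tabD) auto
        with * show "wp_block [Add 9 5 18, Load 9 9] (\<lambda>R m. ?J p p T' R m \<and> R 9 = bit_val (T' r p)) R m"
          by (simp add: env_def)
      qed simp
      have b: "valid (\<lambda>R m. ?J p p T' R m \<and> R 9 = bit_val (T' r p)) (IfNZ 9 process_rows)
          (\<lambda>R m. \<exists>T'. ?J (Suc p) p T' R m) ((26 * n * n + 24 * n + 3) + 1)"
      proof (rule valid_IfNZ)
        show "valid (\<lambda>R m. (?J p p T' R m \<and> R 9 = bit_val (T' r p)) \<and> R 9 \<noteq> 0) process_rows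
            (\<lambda>R m. \<exists>T'. ?J (Suc p) p T' R m) (26 * n * n + 24 * n + 3)"
        proof (cases "pivoted n r p T T' \<and> T' r p \<noteq> 0")
          case True
          with pivoted_step[OF _ _ p] show ?thesis
            by (intro valid_conseq[OF valid_process_rows[OF r p, of u w "n - p" T']]) blast+
        qed (auto simp: valid_def)
      qed (use pivoted_skip[OF _ _ p] in auto)
      have c: "valid (\<lambda>R m. \<exists>T'. ?J (Suc p) p T' R m) (Block [Const 11 1, Add 18 18 11])
        (\<lambda>R m. I (Suc p) (R(1 := 1, 16 := n - Suc p)) m \<and> R 16 = n - p) 2"
        by (rule valid_Block) (auto simp: I_def env_def)
      show ?thesis
        unfolding pivot_def by (rule valid_conseq[OF valid_Seq[OF a valid_Seq[OF b c]]]) auto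
    qed
    show "valid (\<lambda>R m. I p R m \<and> R 16 = n - p) pivot
        (\<lambda>R m. I (Suc p) (R(1 := 1, 16 := n - Suc p)) m \<and> R 16 = n - p) (26 * n * n + 24 * n + 8)"
      by (rule valid_conseq[OF valid_ex[where P = "?J p p", OF body]]) (auto simp: I_def)
  qed auto
  show ?thesis
    unfolding elim_def
    by (rule valid_conseq[OF valid_Seq[OF 1 2]]) (auto simp: I_def algebra_simps)
qed

lemma valid_row_sum:
  assumes j: "j < q"
  shows "valid
    (\<lambda>R m. env n u w b z R \<and> R 15 = x \<and> R 7 = n * n + j * n \<and> tab n q m T)
    row_sum
    (\<lambda>R m. env n u w b z R \<and> R 15 = x \<and> R 14 = (\<Sum>c<n. bit_val (T j c)) \<and> tab n q m T)
    (8 * n + 3)"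
proof -
  define I where "I k R m \<longleftrightarrow> env n u w b z R \<and> R 15 = x \<and> R 7 = n * n + j * n + k \<and>
     R 14 = (\<Sum>c<k. bit_val (T j c)) \<and> tab n q m T" for k R m
  have 1: "valid (\<lambda>R m. env n u w b z R \<and> R 15 = x \<and> R 7 = n * n + j * n \<and> tab n q m T)
     (Block [Const 14 0, Add 8 0 4]) (\<lambda>R m. I 0 R m \<and> R 8 = n) 2"
    by (rule valid_Block) (auto simp: I_def env_def)
  have 2: "valid (\<lambda>R m. I 0 R m \<and> R 8 = n)
     (Loop 8 (Block [Load 9 7, Add 14 14 9, Const 11 1, Add 7 7 11])) (I n) (n * (4 + 4) + 1)"
  proof (rule valid_Loop[where I = I])
    fix k assume "k < n"
    then show "valid (\<lambda>R m. I k R m \<and> R 8 = n - k)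
      (Block [Load 9 7, Add 14 14 9, Const 11 1, Add 7 7 11])
      (\<lambda>R m. I (Suc k) (R(1 := 1, 8 := n - Suc k)) m \<and> R 8 = n - k) 4"
      by (intro valid_Block) (auto simp: I_def env_def tabD[OF _ j])
  qed auto
  show ?thesis
    unfolding row_sum_def by (rule valid_conseq[OF valid_Seq[OF 1 2]]) (auto simp: I_def)
qed

section \<open>The algorithm\<close>

text \<open>Rows \<open>2 k\<close> and \<open>2 k + 1\<close> of the table are the candidates \<open>M\<^sub>k\<close> and \<open>M\<^sub>k + e\<^sub>k\<close>.\<close>

definition columns :: "bit mat \<Rightarrow> nat \<Rightarrow> nat \<Rightarrow> bit" where
  "columns M j c = M $$ (c, j div 2) + (if odd j \<and> c = j div 2 then 1 else 0)"

definition build_table :: com where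
  "build_table = Seq (Block [Add 3 0 4]) (Seq (Loop 3 (Block [Add 2 2 0]))
    (Seq (Block [Add 5 2 4, Const 6 0, Add 3 0 4])
      (Loop 3 (Seq (Block [Add 7 6 4, Add 8 0 4])
        (Seq (Loop 8 (Block [Load 9 7, Store 5 9, Add 10 5 0, Store 10 9, Add 7 7 0,
                             Const 11 1, Add 5 5 11]))
             (Block [Add 10 5 6, Load 9 10, Const 11 1, Sub 9 11 9, Store 10 9,
                     Add 5 5 0, Add 6 6 11]))))))"

definition double_elim :: com where
  "double_elim = Seq elim (Seq (Block [Sub 5 5 0, Const 11 1, Sub 13 13 11])
    (Seq elim (Block [Add 5 5 0, Const 11 1, Add 13 13 11, Const 11 2, Add 12 12 11])))"

definition process_column :: com where
  "process_column = Seq (Block [Sub 5 5 0, Add 7 5 4, Const 15 0]) (Seq row_sum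
     (Seq (Block [Add 15 14 4, Sub 7 5 0]) (Seq row_sum
       (Seq (IfNZ 14 (IfNZ 15 double_elim)) (Block [Sub 5 5 0, Const 11 2, Sub 13 13 11])))))"

definition algorithm :: com where
  "algorithm = Seq build_table (Seq (Block [Add 3 0 4, Add 13 0 0])
     (Seq (Loop 3 process_column) (Block [Add 0 12 4])))"

lemma valid_build_table:
  "valid
    (\<lambda>R m. R = (\<lambda>_. 0)(0 := n) \<and> (\<forall>i<n. \<forall>c<n. m (i * n + c) = bit_val (M $$ (i, c))))
    build_table
    (\<lambda>R m. R 0 = n \<and> R 2 = n * n \<and> R 4 = 0 \<and> R 5 = n * n + 2 * n * n \<and> R 12 = 0 \<and>
       tab n (2 * n) m (columns M))
    (11 * n * n + 19 * n + 7)"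
proof -
  define Src where "Src m \<longleftrightarrow> (\<forall>i<n. \<forall>c<n. m (i * n + c) = bit_val (M $$ (i, c)))" for m
  have Src_upd: "Src (m(n * n + a := v)) \<longleftrightarrow> Src m" for m a v
  proof -
    have "i * n + c \<noteq> n * n + a" if "i < n" "c < n" for i c
    proof -
      have "i * n + c < Suc i * n" using that by simp
      also have "\<dots> \<le> n * n" using that by (intro mult_le_mono1) simp
      finally show ?thesis by simp
    qed
    then show ?thesis by (simp add: Src_def)
  qed
  define H where "H i R m \<longleftrightarrow> R 0 = n \<and> R 2 = i * n \<and> R 4 = 0 \<and> R 12 = 0 \<and> Src m"
    for i and R m :: "nat \<Rightarrow> nat"
  have 1: "valid (\<lambda>R m. R = (\<lambda>_. 0)(0 := n) \<and> (\<forall>i<n. \<forall>c<n. m (i * n + c) = bit_val (M $$ (i, c))))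
     (Block [Add 3 0 4]) (\<lambda>R m. H 0 R m \<and> R 3 = n) 1"
    by (rule valid_Block) (auto simp: H_def Src_def)
  have 2: "valid (\<lambda>R m. H 0 R m \<and> R 3 = n) (Loop 3 (Block [Add 2 2 0])) (H n) (n * (1 + 4) + 1)"
  proof (rule valid_Loop[where I = H])
    show "valid (\<lambda>R m. H i R m \<and> R 3 = n - i) (Block [Add 2 2 0])
      (\<lambda>R m. H (Suc i) (R(1 := 1, 3 := n - Suc i)) m \<and> R 3 = n - i) 1" for i
      by (rule valid_Block) (auto simp: H_def)
  qed auto
  define I where "I k R m \<longleftrightarrow> R 0 = n \<and> R 2 = n * n \<and> R 4 = 0 \<and> R 12 = 0 \<and>
     R 5 = n * n + 2 * k * n \<and> R 6 = k \<and> Src m \<and> tab n (2 * k) m (columns M)"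
    for k and R m :: "nat \<Rightarrow> nat"
  have 3: "valid (H n) (Block [Add 5 2 4, Const 6 0, Add 3 0 4]) (\<lambda>R m. I 0 R m \<and> R 3 = n) 3"
    by (rule valid_Block) (auto simp: H_def I_def tab_def)
  have 4: "valid (\<lambda>R m. I 0 R m \<and> R 3 = n)
      (Loop 3 (Seq (Block [Add 7 6 4, Add 8 0 4])
        (Seq (Loop 8 (Block [Load 9 7, Store 5 9, Add 10 5 0, Store 10 9, Add 7 7 0,
                             Const 11 1, Add 5 5 11]))
             (Block [Add 10 5 6, Load 9 10, Const 11 1, Sub 9 11 9, Store 10 9,
                     Add 5 5 0, Add 6 6 11])))) (I n) (n * ((11 * n + 10) + 4) + 1)"
  proof (rule valid_Loop[where I = I])
    fix k assume k: "k < n"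
    define J where "J c R m \<longleftrightarrow> R 0 = n \<and> R 2 = n * n \<and> R 4 = 0 \<and> R 12 = 0 \<and> R 3 = n - k \<and>
       R 5 = n * n + 2 * k * n + c \<and> R 6 = k \<and> R 7 = k + c * n \<and> Src m \<and>
       tab n (2 * k) m (columns M) \<and>
       (\<forall>c'<c. m (n * n + 2 * k * n + c') = bit_val (M $$ (c', k)) \<and>
               m (n * n + Suc (2 * k) * n + c') = bit_val (M $$ (c', k)))"
      for c and R m :: "nat \<Rightarrow> nat"
    have a: "valid (\<lambda>R m. I k R m \<and> R 3 = n - k) (Block [Add 7 6 4, Add 8 0 4])
        (\<lambda>R m. J 0 R m \<and> R 8 = n) 2"
      by (rule valid_Block) (auto simp: I_def J_def)
    have b: "valid (\<lambda>R m. J 0 R m \<and> R 8 = n)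
        (Loop 8 (Block [Load 9 7, Store 5 9, Add 10 5 0, Store 10 9, Add 7 7 0,
                             Const 11 1, Add 5 5 11])) (J n) (n * (7 + 4) + 1)"
    proof (rule valid_Loop[where I = J])
      fix c assume c: "c < n"
      show "valid (\<lambda>R m. J c R m \<and> R 8 = n - c)
        (Block [Load 9 7, Store 5 9, Add 10 5 0, Store 10 9, Add 7 7 0, Const 11 1, Add 5 5 11])
        (\<lambda>R m. J (Suc c) (R(1 := 1, 8 := n - Suc c)) m \<and> R 8 = n - c) 7"
      proof (rule valid_Block)
        fix R m assume *: "J c R m \<and> R 8 = n - c"
        define v where "v = bit_val (M $$ (c, k))"
        have v: "m (k + c * n) = v" using * c k by (simp add: J_def Src_def v_def add.commute)
        define m' where "m' = m(n * n + 2 * k * n + c := v, n * n + Suc (2 * k) * n + c := v)"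
        have addr: "j * n + c' = i * n + c \<longleftrightarrow> j = i \<and> c' = c" if "c' < n" for j i c'
          by (rule row_col_inject[OF that c])
        have src: "Src m'" using * unfolding m'_def J_def
          by (metis Src_upd add.assoc)
        have old: "tab n (2 * k) m' (columns M)"
          using * addr unfolding m'_def J_def tab_def by (auto simp: add.assoc simp del: mult_Suc)
        have new: "\<forall>c'<Suc c. m' (n * n + 2 * k * n + c') = bit_val (M $$ (c', k)) \<and>
               m' (n * n + Suc (2 * k) * n + c') = bit_val (M $$ (c', k))"
        proof (intro allI impI)
          fix c' assume "c' < Suc c"
          then show "m' (n * n + 2 * k * n + c') = bit_val (M $$ (c', k)) \<and>
               m' (n * n + Suc (2 * k) * n + c') = bit_val (M $$ (c', k))"
            using * c addr[of c' "2 * k" "Suc (2 * k)"] addr[of c' "Suc (2 * k)" "2 * k"]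
              addr[of c' "2 * k" "2 * k"] addr[of c' "Suc (2 * k)" "Suc (2 * k)"]
            unfolding m'_def J_def v_def by (auto simp: add.assoc less_Suc_eq simp del: mult_Suc)
        qed
        have J_Suc: "J (Suc c) R' m'"
          if "R' 0 = R 0" "R' 2 = R 2" "R' 3 = R 3" "R' 4 = R 4" "R' 5 = Suc (R 5)" "R' 6 = R 6"
            "R' 7 = R 7 + R 0" "R' 12 = R 12" for R'
          unfolding J_def using that src old new *[unfolded J_def] by (intro conjI) simp_all
        have *: "R 8 = n - c" "m (R 7) = v" "m' = m(R 5 := v, R 5 + R 0 := v)"
          using * v by (auto simp: J_def m'_def ac_simps)
        show "wp_block [Load 9 7, Store 5 9, Add 10 5 0, Store 10 9, Add 7 7 0, Const 11 1, Add 5 5 11]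
            (\<lambda>R m. J (Suc c) (R(1 := 1, 8 := n - Suc c)) m \<and> R 8 = n - c) R m"
          by (simp add: *(1,2) *(3)[symmetric] J_Suc)
      qed simp
    qed auto
    have c: "valid (J n) (Block [Add 10 5 6, Load 9 10, Const 11 1, Sub 9 11 9, Store 10 9,
                     Add 5 5 0, Add 6 6 11])
        (\<lambda>R m. I (Suc k) (R(1 := 1, 3 := n - Suc k)) m \<and> R 3 = n - k) 7"
    proof (rule valid_Block)
      fix R m assume *: "J n R m"
      define T where "T j c = (if j < 2 * k then columns M j c else M $$ (c, k))" for j c
      have "tab n (Suc (Suc (2 * k))) m T"
        using * unfolding J_def tab_def T_def by (auto simp: less_Suc_eq simp del: mult_Suc)
      then have "tab n (Suc (Suc (2 * k)))
          (m(n * n + Suc (2 * k) * n + k := bit_val (M $$ (k, k) + 1)))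
          (T(Suc (2 * k) := (T (Suc (2 * k)))(k := M $$ (k, k) + 1)))"
        by (rule tab_upd[OF _ k])
      then have "tab n (2 * Suc k) (m(n * n + Suc (2 * k) * n + k := bit_val (M $$ (k, k) + 1)))
          (columns M)"
      proof (rule tab_cong)
        fix j c assume j: "j < 2 * Suc k"
        then have "j < 2 * k \<or> j = 2 * k \<or> j = Suc (2 * k)" by auto
        then show "(T(Suc (2 * k) := (T (Suc (2 * k)))(k := M $$ (k, k) + 1))) j c = columns M j c"
          by (elim disjE) (auto simp: T_def columns_def)
      qed simp
      moreover have "m (n * n + Suc (2 * k) * n + k) = bit_val (M $$ (k, k))"
        using * k unfolding J_def by blast
      moreover have "Src (m(n * n + Suc (2 * k) * n + k := v))" for v
        using * Src_upd[of m "Suc (2 * k) * n + k" v] by (simp add: J_def add.assoc del: mult_Suc)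
      moreover have "R 5 + R 6 = n * n + Suc (2 * k) * n + k" using * by (simp add: J_def)
      ultimately show "wp_block [Add 10 5 6, Load 9 10, Const 11 1, Sub 9 11 9, Store 10 9,
                     Add 5 5 0, Add 6 6 11]
        (\<lambda>R m. I (Suc k) (R(1 := 1, 3 := n - Suc k)) m \<and> R 3 = n - k) R m"
        using * by (simp add: I_def J_def del: mult_Suc) (simp add: algebra_simps bit_val_flip)
    qed simp
    show "valid (\<lambda>R m. I k R m \<and> R 3 = n - k)
       (Seq (Block [Add 7 6 4, Add 8 0 4])
        (Seq (Loop 8 (Block [Load 9 7, Store 5 9, Add 10 5 0, Store 10 9, Add 7 7 0,
                             Const 11 1, Add 5 5 11]))
             (Block [Add 10 5 6, Load 9 10, Const 11 1, Sub 9 11 9, Store 10 9,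
                     Add 5 5 0, Add 6 6 11])))
       (\<lambda>R m. I (Suc k) (R(1 := 1, 3 := n - Suc k)) m \<and> R 3 = n - k) (11 * n + 10)"
      by (rule valid_conseq[OF valid_Seq[OF a valid_Seq[OF b c]]]) auto
  qed auto
  show ?thesis
    unfolding build_table_def
    by (rule valid_conseq[OF valid_Seq[OF 1 valid_Seq[OF 2 valid_Seq[OF 3 4]]]])
       (auto simp: I_def algebra_simps)
qed

context bit_vec_space
begin

lemma pivoted_reduced:
  assumes "pivoted n r n T T'"
  shows "reduced r (\<lambda>j. vec n (T j)) (\<lambda>j. vec n (T' j))"
  using assms unfolding pivoted_def
proof (elim disjE exE conjE)
  assume "\<forall>c<n. T r c = 0" "\<forall>j\<le>r. \<forall>c<n. T' j c = T j c"
  then show ?thesis unfolding reduced_def by (intro disjI1 conjI allI impI eq_vecI) auto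
next
  fix p assume "p < n" "T r p \<noteq> 0"
    "\<forall>j\<le>r. \<forall>c<n. T' j c = (if T j p \<noteq> 0 then T j c + T r c else T j c)"
  then show ?thesis unfolding reduced_def
    by (intro disjI2 exI[of _ p] conjI allI impI eq_vecI) auto
qed

lemma row_sum_eq_0: "(\<Sum>c<n. bit_val (t c)) = 0 \<longleftrightarrow> vec n t = 0\<^sub>v n"
  by (auto simp: vec_eq_iff)

definition interleave :: "(nat \<Rightarrow> bit vec) \<Rightarrow> (nat \<Rightarrow> bit vec) \<Rightarrow> nat \<Rightarrow> bit vec" where
  "interleave a b j = (if even j then a (j div 2) else b (j div 2))"

definition processed :: "(nat \<Rightarrow> bit vec) \<Rightarrow> (nat \<Rightarrow> bit vec) \<Rightarrow> nat \<Rightarrow> nat \<Rightarrow> (nat \<Rightarrow> nat \<Rightarrow> bit) \<Rightarrow> bool" where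
  "processed a b K s T \<longleftrightarrow>
     (\<exists>\<pi>. progress a b K s \<pi> \<and> (\<forall>j<2 * K. vec n (T j) = \<pi> (interleave a b j)))"

definition loop_inv :: "(nat \<Rightarrow> bit vec) \<Rightarrow> (nat \<Rightarrow> bit vec) \<Rightarrow> nat \<Rightarrow> (nat \<Rightarrow> nat) \<Rightarrow> (nat \<Rightarrow> nat) \<Rightarrow> bool" where
  "loop_inv a b K R m \<longleftrightarrow> (\<exists>T s. env n K (2 * s) (n * n + 2 * K * n) (2 * K) R \<and>
      tab n (2 * K) m T \<and> processed a b K s T)"

context
  fixes a b :: "nat \<Rightarrow> bit vec"
  assumes ab: "\<And>k. k < n \<Longrightarrow> a k \<in> vecs" "\<And>k. k < n \<Longrightarrow> b k \<in> vecs"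
begin

lemma interleave_simps [simp]: "interleave a b (2 * k) = a k" "interleave a b (Suc (2 * k)) = b k"
  by (auto simp: interleave_def)

lemma interleave_in_vecs: "j < 2 * n \<Longrightarrow> interleave a b j \<in> vecs"
  using ab by (auto simp: interleave_def)

lemma processed_skip:
  assumes "processed a b (Suc K) s T" "vec n (T (2 * K)) = 0\<^sub>v n \<or> vec n (T (Suc (2 * K))) = 0\<^sub>v n"
  shows "processed a b K s T"
proof -
  obtain \<pi> where pr: "progress a b (Suc K) s \<pi>"
    and T: "\<And>j. j < 2 * Suc K \<Longrightarrow> vec n (T j) = \<pi> (interleave a b j)"
    using assms(1) unfolding processed_def by blast
  have "\<pi> (a K) = 0\<^sub>v n \<or> \<pi> (b K) = 0\<^sub>v n"
    using assms(2) T[of "2 * K"] T[of "Suc (2 * K)"] by auto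
  then have "progress a b K s \<pi>" by (rule progress_skip[OF pr])
  then show ?thesis unfolding processed_def by (intro exI[of _ \<pi>] conjI allI impI T) auto
qed

lemma processed_step:
  assumes "processed a b (Suc K) s T" and K: "K < n"
    and nz: "vec n (T (2 * K)) \<noteq> 0\<^sub>v n" "vec n (T (Suc (2 * K))) \<noteq> 0\<^sub>v n"
    and p1: "pivoted n (Suc (2 * K)) n T T'" and p2: "pivoted n (2 * K) n T' T''"
  shows "processed a b K (Suc s) T''"
proof -
  obtain \<pi> where pr: "progress a b (Suc K) s \<pi>"
    and T: "\<And>j. j \<le> Suc (2 * K) \<Longrightarrow> vec n (T j) = \<pi> (interleave a b j)"
    using assms(1) unfolding processed_def by auto
  have il: "interleave a b j \<in> vecs" if "j \<le> Suc (2 * K)" for j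
    using that K by (intro interleave_in_vecs) simp
  have "additive \<pi>" using pr by (simp add: progress_def)
  then obtain \<pi>1 where k1: "kills \<pi> (interleave a b (Suc (2 * K))) \<pi>1"
    and T': "\<And>j. j \<le> Suc (2 * K) \<Longrightarrow> vec n (T' j) = \<pi>1 (interleave a b j)"
    using reduced_kills[OF _ il T pivoted_reduced[OF p1]] by blast
  have "additive \<pi>1" using k1 by (simp add: kills_def)
  then obtain \<pi>2 where k2: "kills \<pi>1 (interleave a b (2 * K)) \<pi>2"
    and T'': "\<And>j. j \<le> 2 * K \<Longrightarrow> vec n (T'' j) = \<pi>2 (interleave a b j)"
    using reduced_kills[OF _ il T' pivoted_reduced[OF p2]] by (metis le_SucI)
  have "\<pi> (a K) \<noteq> 0\<^sub>v n" "\<pi> (b K) \<noteq> 0\<^sub>v n"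
    using nz T[of "2 * K"] T[of "Suc (2 * K)"] by auto
  then have "progress a b K (Suc s) \<pi>2"
    using progress_step[OF ab pr K _ _ _ _] k1 k2 by simp
  then show ?thesis unfolding processed_def using T'' by auto
qed

lemma valid_double_elim:
  assumes K: "K < n"
    and T: "processed a b (Suc K) s T" "vec n (T (2 * K)) \<noteq> 0\<^sub>v n" "vec n (T (Suc (2 * K))) \<noteq> 0\<^sub>v n"
  shows "valid
    (\<lambda>R m. env n u (2 * s) (n * n + Suc (2 * K) * n) (Suc (Suc (2 * K))) R \<and>
           tab n (Suc (Suc (2 * K))) m T)
    double_elim
    (\<lambda>R m. \<exists>T' s'. env n u (2 * s') (n * n + Suc (2 * K) * n) (Suc (Suc (2 * K))) R \<and>
           tab n (2 * K) m T' \<and> processed a b K s' T')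
    (52 * n * n * n + 48 * n * n + 24 * n + 14)"
proof -
  let ?r = "Suc (2 * K)"
  have r: "Suc ?r \<le> 2 * n" "Suc (2 * K) \<le> 2 * n" using K by auto
  note 1 = valid_elim[OF r(1), of u "2 * s" T]
  have 2: "valid (\<lambda>R m. env n u (2 * s) (n * n + ?r * n) (Suc ?r) R \<and>
        (\<exists>T'. tab n (Suc ?r) m T' \<and> pivoted n ?r n T T'))
      (Block [Sub 5 5 0, Const 11 1, Sub 13 13 11])
      (\<lambda>R m. \<exists>T'. pivoted n ?r n T T' \<and> env n u (2 * s) (n * n + 2 * K * n) ?r R \<and> tab n ?r m T') 3"
    by (rule valid_Block) (auto simp: env_def elim!: tab_cong)
  have 3: "valid (\<lambda>R m. \<exists>T'. pivoted n ?r n T T' \<and> env n u (2 * s) (n * n + 2 * K * n) ?r R \<and> tab n ?r m T')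
      elim
      (\<lambda>R m. env n u (2 * s) (n * n + 2 * K * n) ?r R \<and>
        (\<exists>T'. tab n ?r m T' \<and> processed a b K (Suc s) T')) (26 * n * n * n + 24 * n * n + 12 * n + 3)"
  proof (rule valid_ex)
    fix T'
    show "valid (\<lambda>R m. pivoted n ?r n T T' \<and> env n u (2 * s) (n * n + 2 * K * n) ?r R \<and> tab n ?r m T')
      elim
      (\<lambda>R m. env n u (2 * s) (n * n + 2 * K * n) ?r R \<and>
        (\<exists>T'. tab n ?r m T' \<and> processed a b K (Suc s) T')) (26 * n * n * n + 24 * n * n + 12 * n + 3)"
    proof (cases "pivoted n ?r n T T'")
      case True
      show ?thesis
        by (rule valid_conseq[OF valid_elim[OF r(2), of u "2 * s" T']])
           (use processed_step[OF T(1) K T(2,3) True] in auto)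
    qed (simp add: valid_def)
  qed
  have 4: "valid (\<lambda>R m. env n u (2 * s) (n * n + 2 * K * n) ?r R \<and>
        (\<exists>T'. tab n ?r m T' \<and> processed a b K (Suc s) T'))
      (Block [Add 5 5 0, Const 11 1, Add 13 13 11, Const 11 2, Add 12 12 11])
      (\<lambda>R m. \<exists>T' s'. env n u (2 * s') (n * n + Suc (2 * K) * n) (Suc (Suc (2 * K))) R \<and>
           tab n (2 * K) m T' \<and> processed a b K s' T') 5"
  proof (rule valid_Block)
    fix R m assume *: "env n u (2 * s) (n * n + 2 * K * n) ?r R \<and>
        (\<exists>T'. tab n ?r m T' \<and> processed a b K (Suc s) T')"
    then obtain T' where T': "tab n ?r m T'" "processed a b K (Suc s) T'" by blast
    have "tab n (2 * K) m T'" using T'(1) by (rule tab_cong) auto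
    with * T'(2) show "wp_block [Add 5 5 0, Const 11 1, Add 13 13 11, Const 11 2, Add 12 12 11]
      (\<lambda>R m. \<exists>T' s'. env n u (2 * s') (n * n + Suc (2 * K) * n) (Suc (Suc (2 * K))) R \<and>
           tab n (2 * K) m T' \<and> processed a b K s' T') R m"
      by (auto simp: env_def intro!: exI[of _ T'] exI[of _ "Suc s"])
  qed simp
  show ?thesis
    unfolding double_elim_def
    by (rule valid_conseq[OF valid_Seq[OF 1 valid_Seq[OF 2 valid_Seq[OF 3 4]]]]) auto
qed

lemma valid_process_column:
  assumes K: "K < n"
  shows "valid (loop_inv a b (Suc K)) process_column
    (\<lambda>R m. loop_inv a b K (R(1 := 1, 3 := K)) m \<and> R 3 = Suc K)
    (52 * n * n * n + 48 * n * n + 40 * n + 30)"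
proof -
  let ?r = "Suc (2 * K)"
  let ?post = "\<lambda>R m. \<exists>T' s'. env n (Suc K) (2 * s') (n * n + ?r * n) (Suc ?r) R \<and>
           tab n (2 * K) m T' \<and> processed a b K s' T'"
  have body: "valid
      (\<lambda>R m. env n (Suc K) (2 * s) (n * n + 2 * Suc K * n) (2 * Suc K) R \<and>
             tab n (2 * Suc K) m T \<and> processed a b (Suc K) s T)
      process_column
      (\<lambda>R m. loop_inv a b K (R(1 := 1, 3 := K)) m \<and> R 3 = Suc K)
      (52 * n * n * n + 48 * n * n + 40 * n + 30)" for T s
  proof (cases "processed a b (Suc K) s T")
    case pr: True
    let ?sum = "\<lambda>j. \<Sum>c<n. bit_val (T j c)"
    have 1: "valid (\<lambda>R m. env n (Suc K) (2 * s) (n * n + 2 * Suc K * n) (2 * Suc K) R \<and>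
             tab n (2 * Suc K) m T \<and> processed a b (Suc K) s T)
        (Block [Sub 5 5 0, Add 7 5 4, Const 15 0])
        (\<lambda>R m. env n (Suc K) (2 * s) (n * n + ?r * n) (Suc ?r) R \<and> R 15 = 0 \<and>
               R 7 = n * n + ?r * n \<and> tab n (Suc ?r) m T) 3"
      by (rule valid_Block) (auto simp: env_def)
    note 2 = valid_row_sum[of ?r "Suc ?r" n "Suc K" "2 * s" "n * n + ?r * n" "Suc ?r" 0 T, OF lessI]
    have 3: "valid (\<lambda>R m. env n (Suc K) (2 * s) (n * n + ?r * n) (Suc ?r) R \<and> R 15 = 0 \<and>
               R 14 = ?sum ?r \<and> tab n (Suc ?r) m T)
        (Block [Add 15 14 4, Sub 7 5 0])
        (\<lambda>R m. env n (Suc K) (2 * s) (n * n + ?r * n) (Suc ?r) R \<and> R 15 = ?sum ?r \<and>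
               R 7 = n * n + 2 * K * n \<and> tab n (Suc ?r) m T) 2"
      by (rule valid_Block) (auto simp: env_def)
    have "2 * K < Suc ?r" by simp
    note 4 = valid_row_sum[OF this, of n "Suc K" "2 * s" "n * n + ?r * n" "Suc ?r" "?sum ?r" T]
    have skip: "?post R m" if "env n (Suc K) (2 * s) (n * n + ?r * n) (Suc ?r) R"
      "tab n (Suc ?r) m T" "?sum (2 * K) = 0 \<or> ?sum ?r = 0" for R m
    proof -
      have "tab n (2 * K) m T" using that(2) by (rule tab_cong) auto
      moreover have "processed a b K s T"
        using processed_skip[OF pr] that(3) by (simp only: row_sum_eq_0)
      ultimately show ?thesis using that(1) by blast
    qed
    have 5: "valid (\<lambda>R m. env n (Suc K) (2 * s) (n * n + ?r * n) (Suc ?r) R \<and> R 15 = ?sum ?r \<and>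
               R 14 = ?sum (2 * K) \<and> tab n (Suc ?r) m T)
        (IfNZ 14 (IfNZ 15 double_elim)) ?post
        (52 * n * n * n + 48 * n * n + 24 * n + 14 + 1 + 1)"
    proof (intro valid_IfNZ)
      show "valid (\<lambda>R m. ((env n (Suc K) (2 * s) (n * n + ?r * n) (Suc ?r) R \<and> R 15 = ?sum ?r \<and>
               R 14 = ?sum (2 * K) \<and> tab n (Suc ?r) m T) \<and> R 14 \<noteq> 0) \<and> R 15 \<noteq> 0)
        double_elim ?post (52 * n * n * n + 48 * n * n + 24 * n + 14)"
      proof (cases "?sum (2 * K) = 0 \<or> ?sum ?r = 0")
        case True
        then show ?thesis unfolding valid_def by metis
      next
        case False
        then have nz: "vec n (T (2 * K)) \<noteq> 0\<^sub>v n" "vec n (T ?r) \<noteq> 0\<^sub>v n"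
          unfolding row_sum_eq_0 by blast+
        show ?thesis
          by (rule valid_conseq[OF valid_double_elim[OF K pr nz, of "Suc K"]]) auto
      qed
    next
      fix R m
      assume "(env n (Suc K) (2 * s) (n * n + ?r * n) (Suc ?r) R \<and> R 15 = ?sum ?r \<and>
               R 14 = ?sum (2 * K) \<and> tab n (Suc ?r) m T) \<and> R 14 \<noteq> 0" "R 15 = 0"
      then show "?post R m" by (intro skip) auto
    next
      fix R m
      assume "env n (Suc K) (2 * s) (n * n + ?r * n) (Suc ?r) R \<and> R 15 = ?sum ?r \<and>
               R 14 = ?sum (2 * K) \<and> tab n (Suc ?r) m T" "R 14 = 0"
      then show "?post R m" by (intro skip) auto
    qed
    have 6: "valid ?post (Block [Sub 5 5 0, Const 11 2, Sub 13 13 11])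
        (\<lambda>R m. loop_inv a b K (R(1 := 1, 3 := K)) m \<and> R 3 = Suc K) 3"
      by (rule valid_Block) (auto simp: env_def loop_inv_def)
    show ?thesis
      unfolding process_column_def
      by (rule valid_conseq[OF valid_Seq[OF 1 valid_Seq[OF 2 valid_Seq[OF 3
            valid_Seq[OF 4 valid_Seq[OF 5 6]]]]]]) auto
  qed (simp add: valid_def)
  show ?thesis
    by (rule valid_conseq[OF valid_ex[OF valid_ex[OF body]]]) (auto simp: loop_inv_def)
qed

end

lemma valid_algorithm:
  assumes M: "M \<in> carrier_mat n n"
  shows "valid
    (\<lambda>R m. R = (\<lambda>_. 0)(0 := n) \<and> (\<forall>i<n. \<forall>c<n. m (i * n + c) = bit_val (M $$ (i, c))))
    algorithm
    (\<lambda>R m. R 0 \<le> 2 * minrank_diag n M \<and> minrank_diag n M \<le> R 0)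
    (52 * n * n * n * n + 48 * n * n * n + 51 * n * n + 53 * n + 11)"
proof -
  let ?a = "col M" and ?b = "\<lambda>k. col M k + unit_vec n k"
  have ab: "?a k \<in> vecs" "?b k \<in> vecs" if "k < n" for k
    using M that by auto
  have init: "processed ?a ?b n 0 (columns M)"
  proof -
    have "vec n (columns M j) = interleave ?a ?b j" if "j < 2 * n" for j
    proof -
      have "j div 2 < n" using that by simp
      then show ?thesis
        using M by (intro eq_vecI) (auto simp: interleave_def columns_def)
    qed
    then show ?thesis
      unfolding processed_def using progress_init
      by (intro exI[of _ id]) auto
  qed
  have 1: "valid (\<lambda>R m. R 0 = n \<and> R 2 = n * n \<and> R 4 = 0 \<and> R 5 = n * n + 2 * n * n \<and> R 12 = 0 \<and>
       tab n (2 * n) m (columns M))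
      (Block [Add 3 0 4, Add 13 0 0]) (\<lambda>R m. loop_inv ?a ?b n R m \<and> R 3 = n) 2"
    by (rule valid_Block)
       (use init in \<open>auto simp: loop_inv_def env_def intro!: exI[of _ "columns M"] exI[of _ 0]\<close>)
  have 2: "valid (\<lambda>R m. loop_inv ?a ?b n R m \<and> R 3 = n) (Loop 3 process_column) (loop_inv ?a ?b 0)
     (n * ((52 * n * n * n + 48 * n * n + 40 * n + 30) + 4) + 1)"
  proof (rule valid_Loop[where I = "\<lambda>i. loop_inv ?a ?b (n - i)"])
    fix i assume i: "i < n"
    define K where "K = n - Suc i"
    have K: "K < n" "n - i = Suc K" using i by (auto simp: K_def)
    show "valid (\<lambda>R m. loop_inv ?a ?b (n - i) R m \<and> R 3 = n - i) process_column
      (\<lambda>R m. loop_inv ?a ?b (n - Suc i) (R(1 := 1, 3 := n - Suc i)) m \<and> R 3 = n - i)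
      (52 * n * n * n + 48 * n * n + 40 * n + 30)"
      unfolding K(2) K_def[symmetric]
      by (rule valid_conseq[OF valid_process_column[OF ab K(1)]]) auto
  qed auto
  have 3: "valid (loop_inv ?a ?b 0) (Block [Add 0 12 4])
      (\<lambda>R m. R 0 \<le> 2 * minrank_diag n M \<and> minrank_diag n M \<le> R 0) 1"
  proof (rule valid_Block)
    fix R m assume "loop_inv ?a ?b 0 R m"
    then obtain s \<pi> where "R 12 = 2 * s" "R 4 = 0" "progress ?a ?b 0 s \<pi>"
      unfolding loop_inv_def processed_def env_def by blast
    then show "wp_block [Add 0 12 4] (\<lambda>R m. R 0 \<le> 2 * minrank_diag n M \<and> minrank_diag n M \<le> R 0) R m"
      using minrank_diag_bounds[OF M] by auto
  qed simp
  show ?thesis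
    unfolding algorithm_def
    by (rule valid_conseq[OF valid_Seq[OF valid_build_table valid_Seq[OF 1 valid_Seq[OF 2 3]]]])
       (auto simp: algebra_simps)
qed

end

theorem theorem2:
  shows "\<exists>(P :: instr list) (C :: nat). \<forall>n. \<forall>M \<in> carrier_mat n n.
           \<exists>t. t \<le> C * n ^ 4 + C \<and> halted P (run P t (init_conf n M)) \<and>
               (let k = regs (run P t (init_conf n M)) 0
                in k \<le> 2 * minrank_diag n M \<and> minrank_diag n M \<le> k)"
proof (rule exI[of _ "compile 0 algorithm"], rule exI[of _ 300], intro allI ballI)
  fix n and M :: "bit mat" assume M: "M \<in> carrier_mat n n"
  interpret bit_vec_space n .
  have cell: "i * n + c < n * n" if "i < n" "c < n" for i c
  proof -
    have "i * n + c < Suc i * n" using that by simp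
    also have "\<dots> \<le> n * n" using that by (intro mult_le_mono1) simp
    finally show ?thesis .
  qed
  let ?m = "mem (init_conf n M)"
  have "\<forall>i<n. \<forall>c<n. ?m (i * n + c) = bit_val (M $$ (i, c))"
    using cell by (simp add: init_conf_def)
  then have pre: "(\<lambda>_. 0)(0 := n) = (\<lambda>_. 0 :: nat)(0 := n) \<and>
      (\<forall>i<n. \<forall>c<n. ?m (i * n + c) = bit_val (M $$ (i, c)))" by blast
  obtain t R' m' where t: "t \<le> 52 * n * n * n * n + 48 * n * n * n + 51 * n * n + 53 * n + 11"
    and R': "R' 0 \<le> 2 * minrank_diag n M \<and> minrank_diag n M \<le> R' 0"
    and run: "run (compile 0 algorithm) t \<lparr>pc = 0, regs = (\<lambda>_. 0)(0 := n), mem = ?m\<rparr>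
        = \<lparr>pc = 0 + len algorithm, regs = R', mem = m'\<rparr>"
    by (rule validD[OF valid_algorithm[OF M], OF pre, where prog = "compile 0 algorithm" and
          pre = "[]" and post = "[]" and a = 0])
      (auto simp: fun_upd_def)
  have init: "init_conf n M = \<lparr>pc = 0, regs = (\<lambda>_. 0)(0 := n), mem = ?m\<rparr>"
    by (simp add: init_conf_def)
  have "n * n * n * n = n ^ 4" by (simp add: eval_nat_numeral)
  moreover have "n \<le> n ^ 4" "n * n \<le> n ^ 4" "n * n * n \<le> n ^ 4"
    using power_increasing[of 1 4 n] power_increasing[of 2 4 n] power_increasing[of 3 4 n]
    by (cases "n = 0"; simp add: eval_nat_numeral)+
  ultimately have "t \<le> 300 * n ^ 4 + 300" using t by (simp add: mult.assoc)
  moreover have "halted (compile 0 algorithm) (run (compile 0 algorithm) t (init_conf n M))"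
    using run init by (simp add: halted_def)
  moreover have "regs (run (compile 0 algorithm) t (init_conf n M)) 0 = R' 0"
    using run init by simp
  ultimately show "\<exists>t\<le>300 * n ^ 4 + 300.
        halted (compile 0 algorithm) (run (compile 0 algorithm) t (init_conf n M)) \<and>
        (let k = regs (run (compile 0 algorithm) t (init_conf n M)) 0
         in k \<le> 2 * minrank_diag n M \<and> minrank_diag n M \<le> k)"
    using R' by (intro exI[of _ t]) (simp add: Let_def)
qed

end
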